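(* Let $\mathcal{V}=\alpha+j\beta=\nu_1e_1+\nu_2e_2$, $C=c_1e_1+c_2e_2\in\mathbb{BC}$ and let $Z_0\in\mathbb{BC}\setminus\mathbb{O}_2$ be a fixed bicomplex number. Then $$E_{\mathcal{V},C}(Z_0)=A\sum_{k=0}^{\infty}\frac{(\log Z_0)^k}{k!}\,\mathcal{V}^k,\qquad\text{where } A=\sum_{r=0}^{\infty}\frac{(CZ_0)^r}{\Gamma(\mathcal{V}+r+1)}.$$
   Context: Bicomplex numbers: $\mathbb{BC}=\{w_1+jw_2: w_1,w_2\in\mathbb{C}(i)\}$, where $\mathbb{C}(i)$ is the complex field with unit $i$, $i^2=j^2=-1$, $ij=ji$. Put $e_1=\frac{1+ij}{2}$, $e_2=\frac{1-ij}{2}$, so $e_1+e_2=1$, $e_l^2=e_l$, $e_1e_2=0$. Every $Z=w_1+jw_2$ is uniquely $Z=z_1e_1+z_2e_2$ with $z_1=w_1-iw_2$, $z_2=w_1+iw_2\in\mathbb{C}(i)$, and addition, multiplication and division are componentwise in $e_1,e_2$. The set of zero divisors is $\mathbb{O}_2=\{w_1+jw_2: w_1^2+w_2^2=0\}$, i.e. $z_1z_2=0$. Functions act componentwise: $\Gamma(Y)=\Gamma(y_1)e_1+\Gamma(y_2)e_2$ for $Y=y_1e_1+y_2e_2$ (with $1/\Gamma$ equal to $0$ at the poles of $\Gamma$), $\log Z=(\log z_1)e_1+(\log z_2)e_2$ for $Z\notin\mathbb{O}_2$ (principal complex logarithm), and $Z^{W}=z_1^{w_1}e_1+z_2^{w_2}e_2$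 for $Z=z_1e_1+z_2e_2$, $W=w_1e_1+w_2e_2$ with principal complex powers $z^w=\exp(w\log z)$. Bicomplex Miller-Ross function: $E_{\mathcal{V},C}(Z)=Z^{\mathcal{V}}\sum_{r=0}^{\infty}\frac{(CZ)^r}{\Gamma(\mathcal{V}+r+1)}$ for $\mathcal{V},C,Z\in\mathbb{BC}$. *)

theory Defs
  imports "HOL-Analysis.Analysis"
begin

text \<open>\<open>Bicomplex w\<^sub>1 w\<^sub>2\<close> stands for \<open>w\<^sub>1 + j w\<^sub>2\<close>.\<close>

datatype bicomplex = Bicomplex (bc_re: complex) (bc_im: complex)

lemma bicomplex_eq_iff: "Z = W \<longleftrightarrow> bc_re Z = bc_re W \<and> bc_im Z = bc_im W"
  by (cases Z; cases W) simp

instantiation bicomplex :: comm_ring_1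
begin

definition "0 = Bicomplex 0 0"
definition "1 = Bicomplex 1 0"
definition "Z + W = Bicomplex (bc_re Z + bc_re W) (bc_im Z + bc_im W)"
definition "Z - W = Bicomplex (bc_re Z - bc_re W) (bc_im Z - bc_im W)"
definition "- Z = Bicomplex (- bc_re Z) (- bc_im Z)"
definition "Z * W = Bicomplex (bc_re Z * bc_re W - bc_im Z * bc_im W)
                              (bc_re Z * bc_im W + bc_im Z * bc_re W)"

instance
  by standard
    (simp_all add: bicomplex_eq_iff zero_bicomplex_def one_bicomplex_def plus_bicomplex_def
      minus_bicomplex_def uminus_bicomplex_def times_bicomplex_def algebra_simps)

end

instantiation bicomplex :: real_vector
begin

definition "scaleR r Z = Bicomplex (r *\<^sub>R bc_re Z) (r *\<^sub>R bc_im Z)"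

instance
  by standard
    (simp_all add: bicomplex_eq_iff scaleR_bicomplex_def plus_bicomplex_def
      scaleR_right_distrib scaleR_left_distrib)

end

text \<open>The Euclidean norm is not submultiplicative, so \<open>bicomplex\<close> is a real normed vector space
  but not a \<open>real_normed_algebra\<close>; the norm serves to give infinite series their meaning.\<close>

instantiation bicomplex :: real_normed_vector
begin

definition "norm Z = sqrt ((cmod (bc_re Z))\<^sup>2 + (cmod (bc_im Z))\<^sup>2)"
definition "sgn (Z :: bicomplex) = Z /\<^sub>R norm Z"
definition "dist (Z :: bicomplex) W = norm (Z - W)"
definition [code del]:
  "(uniformity :: (bicomplex \<times> bicomplex) filter) =
     (INF e\<in>{0 <..}. principal {(Z, W). dist Z W < e})"
definition [code del]:
  "open (U :: bicomplex set) \<longleftrightarrow> (\<forall>Z\<in>U. eventually (\<lambda>(Z', W). Z' = Z \<longrightarrow> W \<in> U) uniformity)"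

instance
proof
  have nP: "norm Z = norm (bc_re Z, bc_im Z)" for Z :: bicomplex
    by (simp add: norm_bicomplex_def norm_Pair)
  fix Z W :: bicomplex and r s :: real
  show "norm (Z + W) \<le> norm Z + norm W"
    using norm_triangle_ineq[of "(bc_re Z, bc_im Z)" "(bc_re W, bc_im W)"]
    by (simp add: nP plus_bicomplex_def)
  show "norm (r *\<^sub>R Z) = \<bar>r\<bar> * norm Z"
    using norm_scaleR[of r "(bc_re Z, bc_im Z)"]
    by (simp add: nP scaleR_bicomplex_def)
  show "norm Z = 0 \<longleftrightarrow> Z = 0"
    by (simp add: nP bicomplex_eq_iff zero_bicomplex_def zero_prod_def)
qed (rule sgn_bicomplex_def dist_bicomplex_def uniformity_bicomplex_def open_bicomplex_def)+

end

definition bc_of_complex :: "complex \<Rightarrow> bicomplex" where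
  "bc_of_complex w = Bicomplex w 0"

definition bc_i :: bicomplex where "bc_i = bc_of_complex \<i>"
definition bc_j :: bicomplex where "bc_j = Bicomplex 0 1"

definition bc_e1 :: bicomplex where "bc_e1 = (1 + bc_i * bc_j) /\<^sub>R 2"
definition bc_e2 :: bicomplex where "bc_e2 = (1 - bc_i * bc_j) /\<^sub>R 2"

text \<open>The idempotent components \<open>z\<^sub>1, z\<^sub>2\<close> of \<open>Z = z\<^sub>1 e\<^sub>1 + z\<^sub>2 e\<^sub>2\<close>.\<close>

definition bc_idem1 :: "bicomplex \<Rightarrow> complex" where
  "bc_idem1 Z = bc_re Z - \<i> * bc_im Z"
definition bc_idem2 :: "bicomplex \<Rightarrow> complex" where
  "bc_idem2 Z = bc_re Z + \<i> * bc_im Z"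

definition bc_zero_divisors :: "bicomplex set" where
  "bc_zero_divisors = {Z. (bc_re Z)\<^sup>2 + (bc_im Z)\<^sup>2 = 0}"

text \<open>The reciprocal \<open>1/\<Gamma>\<close>; the library function \<open>rGamma\<close> is \<open>0\<close> at the poles of \<open>\<Gamma>\<close>.\<close>

definition bc_rGamma :: "bicomplex \<Rightarrow> bicomplex" where
  "bc_rGamma Y = bc_of_complex (rGamma (bc_idem1 Y)) * bc_e1
               + bc_of_complex (rGamma (bc_idem2 Y)) * bc_e2"

text \<open>Meaningful off \<open>bc_zero_divisors\<close> only; otherwise the library value \<open>Ln 0 = 0\<close> is used.\<close>

definition bc_log :: "bicomplex \<Rightarrow> bicomplex" where
  "bc_log Z = bc_of_complex (Ln (bc_idem1 Z)) * bc_e1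
            + bc_of_complex (Ln (bc_idem2 Z)) * bc_e2"

text \<open>For a component \<open>z \<noteq> 0\<close>, \<open>z powr w = exp (w * Ln z)\<close>; the library sets \<open>0 powr w = 0\<close>
  (for \<open>w = 0\<close> too).\<close>

definition bc_powr :: "bicomplex \<Rightarrow> bicomplex \<Rightarrow> bicomplex" where
  "bc_powr Z W = bc_of_complex (bc_idem1 Z powr bc_idem1 W) * bc_e1
               + bc_of_complex (bc_idem2 Z powr bc_idem2 W) * bc_e2"

definition miller_ross :: "bicomplex \<Rightarrow> bicomplex \<Rightarrow> bicomplex \<Rightarrow> bicomplex" where
  "miller_ross V C Z = bc_powr Z V * (\<Sum>r. (C * Z) ^ r * bc_rGamma (V + of_nat r + 1))"

lemmas bc_defs = bicomplex_eq_iff zero_bicomplex_def one_bicomplex_def plus_bicomplex_def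
  minus_bicomplex_def times_bicomplex_def scaleR_bicomplex_def bc_of_complex_def
  bc_i_def bc_j_def bc_e1_def bc_e2_def bc_idem1_def bc_idem2_def

lemma bc_units: "bc_i * bc_i = - 1" "bc_j * bc_j = - 1"
  by (simp_all add: bc_defs uminus_bicomplex_def)

lemma bc_e_simps:
  "bc_e1 + bc_e2 = 1" "bc_e1 * bc_e1 = bc_e1" "bc_e2 * bc_e2 = bc_e2" "bc_e1 * bc_e2 = 0"
  by (simp_all add: bc_defs scaleR_conv_of_real)

lemma Bicomplex_eq: "Bicomplex w1 w2 = bc_of_complex w1 + bc_j * bc_of_complex w2"
  by (simp add: bc_defs)

lemma bc_idem_unique:
  "Z = bc_of_complex z1 * bc_e1 + bc_of_complex z2 * bc_e2 \<longleftrightarrow> z1 = bc_idem1 Z \<and> z2 = bc_idem2 Z"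
proof
  assume "Z = bc_of_complex z1 * bc_e1 + bc_of_complex z2 * bc_e2"
  then show "z1 = bc_idem1 Z \<and> z2 = bc_idem2 Z"
    by (simp add: bc_defs complex_eq_iff)
next
  assume "z1 = bc_idem1 Z \<and> z2 = bc_idem2 Z"
  then show "Z = bc_of_complex z1 * bc_e1 + bc_of_complex z2 * bc_e2"
    by (simp add: bc_defs complex_eq_iff field_simps)
qed

lemma bc_idem_mult:
  "bc_idem1 (Z * W) = bc_idem1 Z * bc_idem1 W" "bc_idem2 (Z * W) = bc_idem2 Z * bc_idem2 W"
  by (simp_all add: bc_defs algebra_simps)

lemma bc_zero_divisors_iff: "Z \<in> bc_zero_divisors \<longleftrightarrow> bc_idem1 Z * bc_idem2 Z = 0"
  by (simp add: bc_zero_divisors_def bc_defs algebra_simps power2_eq_square)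

end

theory Submission
  imports Defs
begin

text \<open>In the idempotent components everything splits into two complex statements: the
  Miller-Ross series converges by the ratio test, since \<open>1/\<Gamma>(s) = s/\<Gamma>(s + 1)\<close>, and the series in
  \<open>log Z\<^sub>0\<close> is the exponential series of \<open>\<nu> log z\<close>, whose sum is \<open>z\<^sup>\<nu>\<close> because \<open>z \<noteq> 0\<close>.\<close>

text \<open>Uniqueness of the idempotent decomposition, as rewrite rules: they read off the
  components of any function that is defined componentwise.\<close>

lemma bc_idem_combine:
  "bc_idem1 (bc_of_complex a * bc_e1 + bc_of_complex b * bc_e2) = a"
  "bc_idem2 (bc_of_complex a * bc_e1 + bc_of_complex b * bc_e2) = b"
  by (metis bc_idem_unique)+

lemma bc_idem_add [simp]:
  "bc_idem1 (Z + W) = bc_idem1 Z + bc_idem1 W"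
  "bc_idem2 (Z + W) = bc_idem2 Z + bc_idem2 W"
  by (simp_all add: bc_defs algebra_simps)

lemma bc_idem_scaleR [simp]:
  "bc_idem1 (r *\<^sub>R Z) = r *\<^sub>R bc_idem1 Z"
  "bc_idem2 (r *\<^sub>R Z) = r *\<^sub>R bc_idem2 Z"
  by (simp_all add: bc_defs algebra_simps)

lemma bc_idem_0 [simp]: "bc_idem1 0 = 0" "bc_idem2 0 = 0"
  by (simp_all add: bc_defs)

lemma bc_idem_1 [simp]: "bc_idem1 1 = 1" "bc_idem2 1 = 1"
  by (simp_all add: bc_defs)

lemma bc_idem_of_nat [simp]: "bc_idem1 (of_nat n) = of_nat n" "bc_idem2 (of_nat n) = of_nat n"
  by (induction n) simp_all

lemma bc_idem_power [simp]: "bc_idem1 (Z ^ n) = bc_idem1 Z ^ n" "bc_idem2 (Z ^ n) = bc_idem2 Z ^ n"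
  by (induction n) (simp_all add: bc_idem_mult)

lemma bc_idem_log [simp]: "bc_idem1 (bc_log Z) = Ln (bc_idem1 Z)" "bc_idem2 (bc_log Z) = Ln (bc_idem2 Z)"
  by (simp_all only: bc_log_def bc_idem_combine)

lemma bc_idem_rGamma [simp]:
  "bc_idem1 (bc_rGamma Z) = rGamma (bc_idem1 Z)" "bc_idem2 (bc_rGamma Z) = rGamma (bc_idem2 Z)"
  by (simp_all only: bc_rGamma_def bc_idem_combine)

text \<open>Each map sends \<open>z\<close> to a bicomplex number of norm
  \<open>norm z / sqrt 2\<close>, so the bound 1 suffices. Bounded linear maps preserve sums of
  series, which carries complex convergence over to bicomplex numbers.\<close>

lemma bounded_linear_bc_e:
  "bounded_linear (\<lambda>z. bc_of_complex z * bc_e1)" "bounded_linear (\<lambda>z. bc_of_complex z * bc_e2)"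
proof -
  have "norm (bc_of_complex z * bc_e1) \<le> norm z * 1" "norm (bc_of_complex z * bc_e2) \<le> norm z * 1" for z
    by (auto intro!: real_le_lsqrt simp: norm_bicomplex_def bc_defs norm_mult power2_eq_square)
  then show "bounded_linear (\<lambda>z. bc_of_complex z * bc_e1)"
      "bounded_linear (\<lambda>z. bc_of_complex z * bc_e2)"
    by (intro bounded_linear_intro[where K = 1]; simp add: bc_defs algebra_simps)+
qed

lemma bc_sumsI:
  assumes "(\<lambda>n. bc_idem1 (f n)) sums a" and "(\<lambda>n. bc_idem2 (f n)) sums b"
  shows "f sums (bc_of_complex a * bc_e1 + bc_of_complex b * bc_e2)"
proof -
  have "f = (\<lambda>n. bc_of_complex (bc_idem1 (f n)) * bc_e1 + bc_of_complex (bc_idem2 (f n)) * bc_e2)"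
    using bc_idem_unique by blast
  then show ?thesis
    using sums_add[OF bounded_linear.sums[OF bounded_linear_bc_e(1) assms(1)]
        bounded_linear.sums[OF bounded_linear_bc_e(2) assms(2)]] by simp
qed

lemma summable_power_mult_rGamma:
  fixes z v :: complex
  shows "summable (\<lambda>r. z ^ r * rGamma (v + of_nat r + 1))"
proof -
  \<comment> \<open>For \<open>n \<ge> N\<close> the reverse triangle inequality gives
    \<open>norm (v + n + 1) \<ge> n - norm (v + 1) \<ge> 2 * norm z\<close>, so each term is at most
    half the one before.\<close>
  obtain N :: nat where N: "2 * norm z + norm (v + 1) \<le> real N"
    using real_arch_simple by blast
  have "norm (z ^ Suc n * rGamma (v + of_nat (Suc n) + 1))
      \<le> 1/2 * norm (z ^ n * rGamma (v + of_nat n + 1))" if "n \<ge> N" for n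
  proof -
    define s where "s = v + of_nat n + 1"
    have "real n \<le> norm s + norm (v + 1)"
      using norm_triangle_ineq4[of s "v + 1"] by (simp add: s_def)
    with N that have "2 * norm z \<le> norm s"
      by linarith
    then have "norm z ^ n * norm (rGamma (s + 1)) * (2 * norm z)
        \<le> norm z ^ n * norm (rGamma (s + 1)) * norm s"
      by (intro mult_left_mono) simp_all
    \<comment> \<open>The functional equation in this division-free form also holds at the poles of
      Gamma, so \<open>v\<close> may be any complex number.\<close>
    moreover have "norm (rGamma s) = norm s * norm (rGamma (s + 1))"
      by (metis rGamma_plus1 norm_mult)
    moreover have "v + of_nat (Suc n) + 1 = s + 1"
      by (simp add: s_def)
    ultimately show ?thesis
      by (simp only: s_def[symmetric]) (simp add: norm_mult norm_power mult_ac)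
  qed
  then show ?thesis
    by (intro summable_ratio_test[where c = "1/2" and N = N]) simp_all
qed

lemma sums_bc_powr:
  assumes "Z \<notin> bc_zero_divisors"
  shows "(\<lambda>k. (bc_log Z ^ k /\<^sub>R fact k) * V ^ k) sums bc_powr Z V"
proof -
  \<comment> \<open>At \<open>z = 0\<close> this would fail: \<open>Ln 0 = 0\<close> makes the
    series sum to 1, while \<open>0 powr v = 0\<close>. Off the zero divisors both components are
    nonzero.\<close>
  have powr: "(\<lambda>k. Ln z ^ k * v ^ k /\<^sub>R fact k) sums (z powr v)" if "z \<noteq> 0" for z v :: complex
    using exp_converges[of "v * Ln z"] that
    by (simp add: powr_def power_mult_distrib mult_ac)
  show ?thesis
    unfolding bc_powr_def
    using assms
    by (intro bc_sumsI)
      (simp_all add: bc_idem_mult bc_zero_divisors_iff powr)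
qed

theorem theorem5p2:
  fixes V C Z0 A :: bicomplex and \<alpha> \<beta> \<nu>1 \<nu>2 c1 c2 :: complex
  assumes "V = bc_of_complex \<alpha> + bc_j * bc_of_complex \<beta>"
    and "V = bc_of_complex \<nu>1 * bc_e1 + bc_of_complex \<nu>2 * bc_e2"
    and "C = bc_of_complex c1 * bc_e1 + bc_of_complex c2 * bc_e2"
    and "Z0 \<notin> bc_zero_divisors"
    and "A = (\<Sum>r. (C * Z0) ^ r * bc_rGamma (V + of_nat r + 1))"
  shows "summable (\<lambda>r. (C * Z0) ^ r * bc_rGamma (V + of_nat r + 1)) \<and>
    summable (\<lambda>k. (bc_log Z0 ^ k /\<^sub>R fact k) * V ^ k) \<and>
    miller_ross V C Z0 = A * (\<Sum>k. (bc_log Z0 ^ k /\<^sub>R fact k) * V ^ k)"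
proof -
  have "summable (\<lambda>r. (C * Z0) ^ r * bc_rGamma (V + of_nat r + 1))"
    \<comment> \<open>Only convergence is wanted here, so the component sums are left as the
      unevaluated limits supplied by \<open>summable_sums\<close>.\<close>
    by (rule sums_summable[OF bc_sumsI[OF summable_sums summable_sums]])
      (simp_all add: bc_idem_mult summable_power_mult_rGamma
        flip: power_mult_distrib)
  moreover note sums_bc_powr[OF \<open>Z0 \<notin> bc_zero_divisors\<close>, of V]
  ultimately show ?thesis
    using assms(5) by (simp add: miller_ross_def sums_iff mult.commute)
qed

end
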